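(* Assume Artin's primitive root conjecture for $2$, i.e. that the set $S(2)$ of prime numbers $p$ such that $2$ is a primitive root modulo $p$ is infinite and has asymptotic density $0.3739558136\ldots$ (the Artin constant). Then the set of prime numbers $\alpha$ such that the Riley polynomial of the 2-bridge knot $S(\alpha,\beta)$ is irreducible for each $\beta$ has asymptotic density $\geq 0.3739558136\ldots$.
   Context: Asymptotic density of a set of primes is understood relative to the set of all primes. For a 2-bridge knot $S(\alpha,\beta)$ (Schubert form; $\alpha\ge3$ odd, $\beta$ an odd integer coprime to $\alpha$), put $\epsilon_i=(-1)^{\lfloor i\beta/\alpha\rfloor}$ for $1\le i\le\alpha-1$. The Riley polynomial of $S(\alpha,\beta)$ is the $(1,1)$-entry, an element of $\mathbb Z[\lambda]$, of the matrix $$\begin{pmatrix}1&1\\0&1\end{pmatrix}^{\epsilon_1}\begin{pmatrix}1&0\\\lambda&1\end{pmatrix}^{\epsilon_2}\begin{pmatrix}1&1\\0&1\end{pmatrix}^{\epsilon_3}\cdots\begin{pmatrix}1&1\\0&1\end{pmatrix}^{\epsilon_{\alpha-2}}\begin{pmatrix}1&0\\\lambda&1\end{pmatrix}^{\epsilon_{\alpha-1}}.$$ Irreducibility is in $\mathbb Z[\lambda]$, and "for each $\beta$" ranges over all odd integers $\beta$ for which $S(\alpha,\beta)$ is a 2-bridge knot, i.e. $\beta$ coprime to $\alpha$. *)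

theory Defs
  imports
    "HOL-Analysis.Analysis"
    "HOL-Computational_Algebra.Polynomial"
    "HOL-Number_Theory.Residue_Primitive_Roots"
begin

definition prime_ratio :: "nat set \<Rightarrow> nat \<Rightarrow> real" where
  "prime_ratio A n =
     real (card {p. prime p \<and> p \<le> n \<and> p \<in> A}) / real (card {p::nat. prime p \<and> p \<le> n})"

definition has_prime_density :: "nat set \<Rightarrow> real \<Rightarrow> bool" where
  "has_prime_density A d \<longleftrightarrow> prime_ratio A \<longlonglongrightarrow> d"

text \<open>
  That a set of primes ``has density at least \<open>c\<close>'' is read as a bound on its lower density,
  which always exists and equals the density whenever the latter exists.
\<close>

definition lower_prime_density :: "nat set \<Rightarrow> ereal" where
  "lower_prime_density A = liminf (\<lambda>n. ereal (prime_ratio A n))"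

definition artin_constant :: real where
  "artin_constant = (\<Prod>p. if prime p then 1 - 1 / (real p * (real p - 1)) else 1)"

text \<open>
  Note that \<^term>\<open>residue_primroot p 2\<close> is false for \<open>p = 2\<close>, since it includes \<open>coprime p 2\<close>.
\<close>

definition artin_primes_2 :: "nat set" where
  "artin_primes_2 = {p. prime p \<and> residue_primroot p 2}"

definition two_bridge_knot_params :: "nat \<Rightarrow> int \<Rightarrow> bool" where
  "two_bridge_knot_params \<alpha> \<beta> \<longleftrightarrow> 3 \<le> \<alpha> \<and> odd \<alpha> \<and> odd \<beta> \<and> coprime \<beta> (int \<alpha>)"

definition riley_sign :: "nat \<Rightarrow> int \<Rightarrow> nat \<Rightarrow> int" where
  "riley_sign \<alpha> \<beta> i = (if even \<lfloor>real i * real_of_int \<beta> / real \<alpha>\<rfloor> then 1 else - 1)"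

text \<open>
  Integer powers of a square matrix with respect to the matrix product; the power operation
  inherited by vector types from their entries is componentwise.
\<close>

definition matrix_powi :: "'a::comm_ring_1 ^ 'n ^ 'n \<Rightarrow> int \<Rightarrow> 'a ^ 'n ^ 'n" where
  "matrix_powi A k =
     (if 0 \<le> k then (((**) A) ^^ nat k) (mat 1)
      else (((**) (matrix_inv A)) ^^ nat (- k)) (mat 1))"

text \<open>Here \<^term>\<open>[:0, 1:] :: int poly\<close> is the indeterminate \<open>\<lambda>\<close>.\<close>

definition riley_generator :: "nat \<Rightarrow> int poly ^ 2 ^ 2" where
  "riley_generator i =
     (if odd i then vector [vector [1, 1], vector [0, 1]]
      else vector [vector [1, 0], vector [[:0, 1:], 1]])"

definition riley_matrix :: "nat \<Rightarrow> int \<Rightarrow> int poly ^ 2 ^ 2" where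
  "riley_matrix \<alpha> \<beta> =
     foldr (**) (map (\<lambda>i. matrix_powi (riley_generator i) (riley_sign \<alpha> \<beta> i)) [1..<\<alpha>]) (mat 1)"

definition riley_poly :: "nat \<Rightarrow> int \<Rightarrow> int poly" where
  "riley_poly \<alpha> \<beta> = riley_matrix \<alpha> \<beta> $ 1 $ 1"

text \<open>
  The bound \<open>3 \<le> \<alpha>\<close> excludes the prime 2, which is not the first parameter of any 2-bridge knot
  and for which the condition on \<open>\<beta>\<close> would be vacuous.
\<close>

definition riley_irreducible_primes :: "nat set" where
  "riley_irreducible_primes =
     {\<alpha>. prime \<alpha> \<and> 3 \<le> \<alpha> \<and>
         (\<forall>\<beta>. two_bridge_knot_params \<alpha> \<beta> \<longrightarrow> irreducible (riley_poly \<alpha> \<beta>))}"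

end

(*
  Modulo 2 each matrix in the Riley product equals its own inverse, so the Riley polynomial of
  S(p, b) does not depend on b there. Substituting t + 1/t for the variable and multiplying by
  t^((p-1)/2) turns it into 1 + t + ... + t^(p-1), which is irreducible over the field with two
  elements when 2 is a primitive root modulo p. A factorization over the integers would reduce to
  one of this polynomial without loss of degree, and a constant factor is a unit because the
  constant coefficient of the Riley polynomial is 1. Hence the primes of the Artin conjecture are
  among those in the conclusion.
*)

theory Submission
  imports Defs "HOL-Computational_Algebra.Polynomial_Factorial" "HOL-Library.Z2"
begin

hide_const (open) up_ring.coeff up_ring.monom module.smult

section \<open>Polynomials over finite fields\<close>

lemma UNIV_bit: "(UNIV :: bit set) = {0, 1}"
  by (metis (full_types) UNIV_eq_I bit_not_one_iff insertCI)

instance bit :: finite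
  by standard (simp add: UNIV_bit)

lemma bij_betw_Poly:
  "bij_betw Poly {xs :: 'a::zero list. length xs = d} {p. \<forall>i\<ge>d. coeff p i = 0}"
proof (rule bij_betwI')
  fix xs ys :: "'a list"
  assume len: "xs \<in> {xs. length xs = d}" "ys \<in> {xs. length xs = d}"
  show "(Poly xs = Poly ys) = (xs = ys)"
  proof
    assume eq: "Poly xs = Poly ys"
    show "xs = ys"
    proof (rule nth_equalityI)
      fix i assume "i < length xs"
      then show "xs ! i = ys ! i"
        using arg_cong[OF eq, of "\<lambda>p. coeff p i"] len by (simp add: nth_default_def)
    qed (use len in simp)
  qed simp
next
  fix xs :: "'a list"
  assume "xs \<in> {xs. length xs = d}"
  then show "Poly xs \<in> {p. \<forall>i\<ge>d. coeff p i = 0}"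
    by (auto simp: nth_default_def)
next
  fix p :: "'a poly"
  assume "p \<in> {p. \<forall>i\<ge>d. coeff p i = 0}"
  then have "p = Poly (map (coeff p) [0..<d])"
    by (auto simp: poly_eq_iff nth_default_def)
  then show "\<exists>xs\<in>{xs. length xs = d}. p = Poly xs"
    by (intro bexI[of _ "map (coeff p) [0..<d]"]) auto
qed

text \<open>Coefficient lists of length \<open>d\<close>, padded with zeros, enumerate these
  polynomials. For \<open>d = 0\<close> the set is empty while the power is 1.\<close>

lemma finite_card_poly_degree_less:
  assumes "d > 0"
  shows "finite {p :: 'a::{zero,finite} poly. degree p < d}" (is "finite ?S")
    and "card {p :: 'a poly. degree p < d} = CARD('a) ^ d"
proof -
  have "?S = {p. \<forall>i\<ge>d. coeff p i = 0}"
    using assms by (auto simp: coeff_eq_0 intro: degree_lessI)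
  moreover have "finite {xs :: 'a list. length xs = d}"
    and "card {xs :: 'a list. length xs = d} = CARD('a) ^ d"
    using finite_lists_length_eq[of "UNIV :: 'a set" d] card_lists_length_eq[of "UNIV :: 'a set" d]
    by simp_all
  ultimately show "finite ?S" and "card ?S = CARD('a) ^ d"
    using bij_betw_finite[OF bij_betw_Poly[of d, where 'a = 'a]]
      bij_betw_same_card[OF bij_betw_Poly[of d, where 'a = 'a]] by simp_all
qed

text \<open>Fermat's little theorem in the residue field of \<open>h\<close>: multiplication by
  \<open>a\<close> permutes the nonzero residues \<open>S\<close>, so their product can be
  cancelled.\<close>

lemma fermat_poly:
  fixes h a :: "'a::{field,finite} poly"
  assumes irr: "irreducible h" and ndvd: "\<not> h dvd a"
  shows "h dvd a ^ (CARD('a) ^ degree h - 1) - 1"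
proof -
  define S where "S = {r :: 'a poly. degree r < degree h} - {0}"
  have prime: "prime_elem h"
    using irr by (rule field_poly_irreducible_imp_prime)
  then have h0: "h \<noteq> 0"
    by auto
  have d0: "degree h > 0"
    using irr h0 by (auto simp: irreducible_def is_unit_iff_degree)
  have fin: "finite S" and card: "card S = CARD('a) ^ degree h - 1"
    using finite_card_poly_degree_less[OF d0, where 'a = 'a] d0 by (simp_all add: S_def)
  have S_ndvd: "\<not> h dvd r" if "r \<in> S" for r
    using that by (auto simp: S_def dest: dvd_imp_degree_le)
  define f where "f r = (a * r) mod h" for r
  have "f ` S \<subseteq> S"
  proof safe
    fix r assume "r \<in> S"
    then have "\<not> h dvd a * r"
      using S_ndvd ndvd prime by (simp add: prime_elem_dvd_mult_iff)
    then show "f r \<in> S"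
      using degree_mod_less'[OF h0, of "a * r"] by (simp add: S_def f_def dvd_eq_mod_eq_0)
  qed
  moreover have inj: "inj_on f S"
  proof
    fix r s assume r: "r \<in> S" and s: "s \<in> S" and "f r = f s"
    then have "h dvd a * (r - s)"
      by (simp add: f_def mod_eq_dvd_iff algebra_simps)
    then have "h dvd r - s"
      using ndvd prime by (simp add: prime_elem_dvd_mult_iff)
    moreover have "degree (r - s) < degree h"
      using r s degree_diff_less[of r "degree h" s] by (auto simp: S_def)
    ultimately show "r = s"
      using dvd_imp_degree_le[of h "r - s"] by auto
  qed
  ultimately have "f ` S = S"
    using fin by (simp add: endo_inj_surj)
  then have "(\<Prod>r\<in>S. f r) = \<Prod>S"
    using inj by (metis prod.reindex_cong)
  moreover have "[(\<Prod>r\<in>S. a * r) = (\<Prod>r\<in>S. f r)] (mod h)"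
    by (rule cong_prod) (simp add: f_def cong_def)
  ultimately have "[a ^ card S * \<Prod>S = \<Prod>S] (mod h)"
    by (simp add: prod.distrib)
  then have "h dvd (a ^ card S - 1) * \<Prod>S"
    by (simp add: cong_iff_dvd_diff algebra_simps)
  moreover have "\<not> h dvd \<Prod>T" if "T \<subseteq> S" for T
    using finite_subset[OF that fin] that
  proof (induction T rule: finite_induct)
    case empty
    then show ?case
      using irr by (simp add: irreducible_def)
  next
    case (insert r T)
    then show ?case
      using S_ndvd prime by (simp add: prime_elem_dvd_mult_iff)
  qed
  ultimately show ?thesis
    using prime card by (metis prime_elem_dvd_mult_iff subset_refl)
qed

text \<open>A nonconstant divisor of least degree is irreducible.\<close>

lemma exists_irreducible_factor:
  fixes f :: "'a::field poly"
  assumes "degree f > 0"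
  obtains h where "irreducible h" "h dvd f"
proof -
  obtain h where h: "degree h > 0" "h dvd f"
    and min: "\<And>g. degree g > 0 \<Longrightarrow> g dvd f \<Longrightarrow> degree h \<le> degree g"
    using ex_has_least_nat[of "\<lambda>h. degree h > 0 \<and> h dvd f" f degree] assms by auto
  have h0: "h \<noteq> 0"
    using h(1) by auto
  have "irreducible h"
  proof (rule irreducibleI)
    show "h \<noteq> 0" "\<not> is_unit h"
      using h(1) h0 by (simp_all add: is_unit_iff_degree)
    fix a b assume ab: "h = a * b"
    then have nz: "a \<noteq> 0" "b \<noteq> 0" and deg: "degree h = degree a + degree b"
      using h0 by (auto simp: degree_mult_eq)
    have "a dvd f" "b dvd f"
      using ab h(2) by (auto intro: dvd_trans)
    then have "degree a = 0 \<or> degree b = 0"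
      using min[of a] min[of b] deg by fastforce
    then show "is_unit a \<or> is_unit b"
      using nz by (auto simp: is_unit_iff_degree)
  qed
  then show ?thesis
    using h(2) that by blast
qed

lemma dvd_power_diff_one_coprime:
  fixes x h :: "'a::comm_ring_1"
  assumes "h dvd x ^ a - 1" "h dvd x ^ b - 1" "coprime a b" "a > 0"
  shows "h dvd x - 1"
proof -
  have pow: "h dvd x ^ (n * k) - 1" if "h dvd x ^ n - 1" for n k
  proof -
    have "x ^ n - 1 dvd (x ^ n) ^ k - 1 ^ k"
      by (metis dvd_triv_left power_diff_sumr2)
    then show ?thesis
      using that by (metis dvd_trans power_mult power_one)
  qed
  \<comment> \<open>This form of Bezout keeps the exponents natural, so no inverse of
    \<open>x\<close> modulo \<open>h\<close> occurs.\<close>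
  obtain u v where uv: "a * u = b * v + 1"
    using bezout_nat[of a b] assms(3,4) by auto
  have eq: "x - 1 = (x ^ (a * u) - 1) - x * (x ^ (b * v) - 1)"
    by (simp add: uv algebra_simps)
  show ?thesis
    unfolding eq by (intro dvd_diff dvd_mult pow assms)
qed

lemma degree_sum_powers_X: "degree (\<Sum>i<Suc n. [:0, 1 :: 'a::comm_ring_1:] ^ i) = n"
proof -
  have coeff: "coeff (\<Sum>i<Suc n. [:0, 1 :: 'a:] ^ i) k = (if k < Suc n then 1 else 0)" for k
    unfolding monom_altdef[of 1, simplified, symmetric] by (simp add: coeff_sum)
  show ?thesis
  proof (rule antisym)
    show "degree (\<Sum>i<Suc n. [:0, 1 :: 'a:] ^ i) \<le> n"
      by (rule degree_le) (simp add: coeff del: sum.lessThan_Suc)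
    show "n \<le> degree (\<Sum>i<Suc n. [:0, 1 :: 'a:] ^ i)"
      by (rule le_degree) (simp add: coeff del: sum.lessThan_Suc)
  qed
qed

text \<open>
  An irreducible factor of degree \<open>d\<close> makes the class of \<open>X\<close> an element of order \<open>p\<close> in a group
  of order \<open>q\<^sup>d - 1\<close>, so the order \<open>p - 1\<close> of \<open>q\<close> modulo \<open>p\<close> divides \<open>d\<close>.
\<close>

lemma irreducible_cyclotomic_of_primroot:
  fixes p :: nat
  assumes p: "prime p" and root: "residue_primroot p CARD('a::{field,finite})"
    and p0: "of_nat p \<noteq> (0 :: 'a)"
  shows "irreducible (\<Sum>i<p. [:0, 1 :: 'a:] ^ i)"
proof -
  define X where "X = [:0, 1 :: 'a:]"
  define F where "F = (\<Sum>i<p. X ^ i)"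
  have p2: "p \<ge> 2"
    using p by (rule prime_ge_2_nat)
  have degF: "degree F = p - 1"
    using degree_sum_powers_X[of "p - 1", where 'a = 'a] p2 by (simp add: F_def X_def)
  then obtain h where irr: "irreducible h" and hF: "h dvd F"
    using exists_irreducible_factor[of F] p2 by auto
  have nunit: "\<not> is_unit h"
    using irr by (simp add: irreducible_def)
  have "h \<noteq> 0"
    using irr by auto
  then have d0: "degree h > 0"
    using nunit by (auto simp: is_unit_iff_degree)
  have F_eq: "X ^ p - 1 = (X - 1) * F"
    unfolding F_def by (rule power_diff_1_eq)
  then have hp: "h dvd X ^ p - 1"
    using hF by simp
  \<comment> \<open>If \<open>X\<close> were 1 modulo \<open>h\<close>, then \<open>F\<close> would
    be \<open>p\<close> there, and \<open>h\<close> would divide a nonzero constant.\<close>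
  have hX1: "\<not> h dvd X - 1"
  proof
    assume h1: "h dvd X - 1"
    have "h dvd X ^ i - 1" for i
      using h1 by (metis dvd_trans dvd_triv_left power_diff_1_eq)
    then have "h dvd (\<Sum>i<p. X ^ i - 1)"
      by (intro dvd_sum) auto
    then have "h dvd F - of_nat p"
      by (simp add: F_def sum_subtractf)
    then have "h dvd of_nat p"
      using hF by (metis diff_diff_eq2 add_diff_cancel_left' dvd_diff)
    moreover have "is_unit (of_nat p :: 'a poly)"
      using p0 by (simp add: of_nat_poly is_unit_pCons_iff)
    ultimately show False
      using nunit dvd_unit_imp_unit by blast
  qed
  have "\<not> h dvd X"
  proof
    assume "h dvd X"
    then have "h dvd X ^ p"
      using p2 by (intro dvd_trans[OF _ dvd_power]) auto
    then have "h dvd X ^ p - (X ^ p - 1)"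
      using hp by (rule dvd_diff)
    then show False
      using nunit by simp
  qed
  then have "h dvd X ^ (CARD('a) ^ degree h - 1) - 1"
    using irr by (intro fermat_poly)
  \<comment> \<open>Coprime exponents would force \<open>h\<close> to divide
    \<open>X - 1\<close>.\<close>
  then have "\<not> coprime p (CARD('a) ^ degree h - 1)"
    using dvd_power_diff_one_coprime[OF hp] hX1 p2 by auto
  then have "p dvd CARD('a) ^ degree h - 1"
    using p by (metis prime_imp_coprime)
  then have "[CARD('a) ^ degree h = 1] (mod p)"
    by (simp add: cong_altdef_nat)
  then have "ord p CARD('a) dvd degree h"
    by (simp only: ord_divides)
  moreover have "ord p CARD('a) = p - 1"
    using root p by (simp add: residue_primroot_def totient_prime)
  \<comment> \<open>So \<open>h\<close> already has the degree of \<open>F\<close>, and its cofactor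
    is constant.\<close>
  ultimately have "degree F \<le> degree h"
    using d0 degF by (simp add: dvd_imp_le)
  moreover obtain c where c: "F = h * c"
    using hF by (elim dvdE)
  moreover have "F \<noteq> 0"
    using degF p2 by auto
  ultimately have "is_unit c"
    by (auto simp: is_unit_iff_degree degree_mult_eq)
  then show ?thesis
    using irr c by (simp add: F_def X_def mult.commute[of h] irreducible_mult_unit_left)
qed

section \<open>Homogenization of integer polynomials\<close>

text \<open>
  This is \<open>t\<^sup>m f(u/t)\<close> without the division, provided \<open>m \<ge> degree f\<close>; otherwise the
  coefficients of \<open>f\<close> above \<open>m\<close> are dropped.
\<close>

definition homog :: "'a::comm_ring_1 \<Rightarrow> 'a \<Rightarrow> nat \<Rightarrow> int poly \<Rightarrow> 'a" where
  "homog u t m f = (\<Sum>i\<le>m. of_int (coeff f i) * u ^ i * t ^ (m - i))"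

lemma homog_add: "homog u t m (f + g) = homog u t m f + homog u t m g"
  by (simp add: homog_def sum.distrib algebra_simps)

lemma homog_smult: "homog u t m (smult c f) = of_int c * homog u t m f"
  by (simp add: homog_def sum_distrib_left algebra_simps)

lemma homog_pCons:
  "homog u t (Suc m) (pCons a f) = of_int a * t ^ Suc m + u * homog u t m f"
  unfolding homog_def
  by (subst sum.atMost_Suc_shift) (simp add: sum_distrib_left algebra_simps)

lemma homog_add_index:
  assumes "degree f \<le> m"
  shows "homog u t (m + k) f = t ^ k * homog u t m f"
proof (induction k)
  case (Suc k)
  have "homog u t (m + Suc k) f = (\<Sum>i\<le>m + k. of_int (coeff f i) * u ^ i * t ^ (Suc (m + k) - i))"
    using assms by (simp add: homog_def coeff_eq_0)
  also have "\<dots> = t * homog u t (m + k) f"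
    by (auto simp: homog_def sum_distrib_left Suc_diff_le intro!: sum.cong)
  finally show ?case
    by (simp add: Suc)
qed simp

lemma homog_mult:
  assumes "degree f \<le> m" "degree g \<le> n"
  shows "homog u t (m + n) (f * g) = homog u t m f * homog u t n g"
  using assms(1)
\<comment> \<open>Each step peels off the constant coefficient of \<open>f\<close>. It multiplies
  \<open>g\<close> homogenized at a larger index, which by \<open>homog_add_index\<close> only adds
  powers of \<open>t\<close>.\<close>
proof (induction m arbitrary: f)
  case 0
  then obtain a where "f = [:a:]"
    by (auto elim: degree_eq_zeroE)
  then show ?case
    by (simp add: homog_smult) (simp add: homog_def)
next
  case (Suc m)
  obtain a f' where f: "f = pCons a f'"
    by (rule pCons_cases)
  then have "degree f' \<le> m"
    using Suc.prems by (auto split: if_splits)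
  then show ?case
    using homog_add_index[OF assms(2), of u t "Suc m"]
    by (simp add: f homog_add homog_smult homog_pCons Suc.IH algebra_simps)
qed

text \<open>The \<open>i\<close>-th term has degree at most \<open>2 * i + (m - i)\<close>, so
  degree \<open>2 * m\<close> can come only from \<open>i = m\<close>.\<close>

lemma degree_homog_le:
  fixes u t :: "'a::comm_ring_1 poly"
  assumes "degree u \<le> 2" "degree t \<le> 1"
  shows "degree (homog u t m f) \<le> 2 * m"
  unfolding homog_def
proof (rule degree_sum_le)
  fix i assume "i \<in> {..m}"
  have "degree (of_int (coeff f i) * u ^ i * t ^ (m - i)) \<le> degree (u ^ i) + degree (t ^ (m - i))"
    using degree_mult_le[of "of_int (coeff f i) * u ^ i" "t ^ (m - i)"]
      degree_mult_le[of "of_int (coeff f i)" "u ^ i"] by simp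
  also have "\<dots> \<le> degree u * i + degree t * (m - i)"
    by (intro add_mono degree_power_le)
  also have "\<dots> \<le> 2 * i + 1 * (m - i)"
    using assms by (intro add_mono mult_right_mono) auto
  also have "\<dots> \<le> 2 * m"
    using \<open>i \<in> {..m}\<close> by auto
  finally show "degree (of_int (coeff f i) * u ^ i * t ^ (m - i)) \<le> 2 * m" .
qed simp

text \<open>Full degree \<open>2 * n\<close> passes to the homogenization of each factor, so a unit
  there comes from a constant factor of \<open>f\<close>. The unit constant coefficient rules out
  nontrivial constant factors.\<close>

lemma irreducible_if_irreducible_homog:
  fixes u t :: "'a::field poly"
  assumes deg: "degree f \<le> n" and unit_coeff: "is_unit (coeff f 0)"
    and u: "degree u \<le> 2" and t: "degree t \<le> 1"
    and irr: "irreducible (homog u t n f)" and full: "degree (homog u t n f) = 2 * n"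
  shows "irreducible f"
proof (rule irreducibleI)
  have nz: "homog u t n f \<noteq> 0" and "\<not> is_unit (homog u t n f)"
    using irr by (auto simp: irreducible_def)
  then have "n > 0"
    using full by (simp add: is_unit_iff_degree)
  \<comment> \<open>If \<open>degree f = n - k\<close>, a factor \<open>t ^ k\<close> splits off and
    the total degree is at most \<open>2 * n - k\<close>.\<close>
  have drop: "2 * n \<le> n + degree f"
  proof -
    obtain k where k: "n = degree f + k"
      using deg le_Suc_ex by blast
    then have "homog u t n f = t ^ k * homog u t (degree f) f"
      by (simp add: homog_add_index)
    then have "2 * n \<le> degree (t ^ k) + degree (homog u t (degree f) f)"
      by (metis full degree_mult_le)
    moreover have "degree (t ^ k) \<le> 1 * k"
      using degree_power_le[of t k] t by (meson mult_le_mono1 order_trans)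
    ultimately show ?thesis
      using degree_homog_le[OF u t, of "degree f" f] k by linarith
  qed
  then have degf: "degree f = n"
    using deg by linarith
  show "f \<noteq> 0" "\<not> is_unit f"
    using degf \<open>n > 0\<close> by (auto simp: is_unit_poly_iff)
  fix a b assume ab: "f = a * b"
  have nz': "a \<noteq> 0" "b \<noteq> 0"
    using ab \<open>f \<noteq> 0\<close> by auto
  then have sum: "n = degree a + degree b"
    using ab degf by (simp add: degree_mult_eq)
  define A B where "A = homog u t (degree a) a" and "B = homog u t (degree b) b"
  have AB: "homog u t n f = A * B"
    by (simp add: A_def B_def ab sum homog_mult)
  then have "degree A + degree B = 2 * n"
    using nz full by (auto simp: degree_mult_eq)
  moreover have "degree A \<le> 2 * degree a" "degree B \<le> 2 * degree b"
    unfolding A_def B_def by (intro degree_homog_le u t)+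
  ultimately have eq: "degree A = 2 * degree a" "degree B = 2 * degree b"
    using sum by linarith+
  have "is_unit A \<or> is_unit B"
    using irr AB by (rule irreducibleD)
  then have "degree a = 0 \<or> degree b = 0"
    using eq nz AB by (auto simp: is_unit_iff_degree)
  moreover have "is_unit (coeff a 0)" "is_unit (coeff b 0)"
    using unit_coeff by (simp_all only: ab coeff_mult_0 is_unit_mult_iff)
  ultimately show "is_unit a \<or> is_unit b"
    by (auto elim!: degree_eq_zeroE simp: is_unit_const_poly_iff)
qed

section \<open>Riley polynomials modulo 2\<close>

text \<open>\<open>matrix_inv\<close> is a choice operator; uniqueness of two-sided inverses pins
  down its value.\<close>

lemma matrix_inv_eqI:
  fixes A B :: "'a::comm_ring_1 ^ 'n ^ 'n"
  assumes "A ** B = mat 1" "B ** A = mat 1"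
  shows "matrix_inv A = B"
  unfolding matrix_inv_def
proof (rule some_equality)
  fix C assume "A ** C = mat 1 \<and> C ** A = mat 1"
  then show "C = B"
    by (metis assms(2) matrix_mul_assoc matrix_mul_lid matrix_mul_rid)
qed (use assms in simp)

lemma matrix_powi_one: "matrix_powi A 1 = A"
  by (simp add: matrix_powi_def)

lemma matrix_powi_minus_one: "matrix_powi A (- 1) = matrix_inv A"
  by (simp add: matrix_powi_def)

lemma matrix_2x2_mult_nth:
  fixes A B :: "'a::semiring_1 ^ 2 ^ 2"
  shows "(A ** B) $ i $ j = A $ i $ 1 * B $ 1 $ j + A $ i $ 2 * B $ 2 $ j"
  by (simp add: matrix_matrix_mult_def sum_2)

lemma riley_sign_cases: "riley_sign \<alpha> \<beta> i = 1 \<or> riley_sign \<alpha> \<beta> i = - 1"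
  by (simp add: riley_sign_def)

text \<open>Inverting a unipotent triangular matrix negates its off-diagonal entry, so one formula
  carrying the sign as entry covers both exponents.\<close>

lemma riley_generator_powi_odd:
  assumes "odd i"
  shows "matrix_powi (riley_generator i) (riley_sign \<alpha> \<beta> i) =
    vector [vector [1, [:riley_sign \<alpha> \<beta> i:]], vector [0, 1]]"
proof -
  have "matrix_inv (riley_generator i) = vector [vector [1, [:- 1:]], vector [0, 1]]"
    using assms
    by (intro matrix_inv_eqI)
      (simp_all add: riley_generator_def vec_eq_iff forall_2 matrix_2x2_mult_nth mat_def one_pCons)
  then show ?thesis
    using riley_sign_cases[of \<alpha> \<beta> i] assms
    by (auto simp: matrix_powi_one matrix_powi_minus_one) (simp add: riley_generator_def one_pCons)
qed

lemma riley_generator_powi_even: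
  assumes "even i"
  shows "matrix_powi (riley_generator i) (riley_sign \<alpha> \<beta> i) =
    vector [vector [1, 0], vector [[:0, riley_sign \<alpha> \<beta> i:], 1]]"
proof -
  have "matrix_inv (riley_generator i) = vector [vector [1, 0], vector [[:0, - 1:], 1]]"
    using assms
    by (intro matrix_inv_eqI)
      (simp_all add: riley_generator_def vec_eq_iff forall_2 matrix_2x2_mult_nth mat_def one_pCons)
  then show ?thesis
    using riley_sign_cases[of \<alpha> \<beta> i] assms
    by (auto simp: matrix_powi_one matrix_powi_minus_one) (simp add: riley_generator_def)
qed

lemma bit_poly_two_eq_zero: "(2 :: bit poly) = 0"
  by (simp add: numeral_poly)

lemma bit_poly_minus: "- f = (f :: bit poly)"
  using bit_poly_two_eq_zero by (metis add_eq_0_iff mult_2 mult_zero_left)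

text \<open>Here the dependence on \<open>\<beta>\<close> disappears, since 1 and -1 agree modulo
  2.\<close>

lemma of_int_riley_sign: "(of_int (riley_sign \<alpha> \<beta> i) :: bit poly) = 1"
  using riley_sign_cases[of \<alpha> \<beta> i] bit_poly_minus[of 1] by auto

text \<open>
  Homogenizing with \<open>u = t\<^sup>2 + 1\<close> is the substitution \<open>\<lambda> = t + 1/t\<close>. The product of two
  consecutive generators has determinant 1 and, modulo 2, trace \<open>\<lambda>\<close>, so its eigenvalues become
  \<open>t\<close> and \<open>1/t\<close>.
\<close>

lemma riley_product_first_column:
  fixes \<alpha> :: nat and \<beta> :: int and t :: "bit poly"
  defines "M \<equiv> \<lambda>j k. foldr (**)
    (map (\<lambda>i. matrix_powi (riley_generator i) (riley_sign \<alpha> \<beta> i)) [j..<j + 2 * k]) (mat 1)"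
  assumes "odd j"
  shows "degree (M j k $ 1 $ 1) \<le> k \<and> degree (M j k $ 2 $ 1) \<le> k \<and>
    coeff (M j k $ 1 $ 1) 0 = 1 \<and> coeff (M j k $ 2 $ 1) 0 = 0 \<and>
    homog (t\<^sup>2 + 1) t k (M j k $ 1 $ 1) = (\<Sum>i<Suc (2 * k). t ^ i) \<and>
    homog (t\<^sup>2 + 1) t k (M j k $ 2 $ 1) = t ^ (2 * k) + 1"
  using \<open>odd j\<close>
\<comment> \<open>Two generators are peeled off on the left, so the start moves to
  \<open>j + 2\<close> with the same parity. Left multiplication acts on each column separately, so
  the first column suffices.\<close>
proof (induction k arbitrary: j)
  case 0
  then show ?case
    using bit_poly_two_eq_zero by (simp add: M_def mat_def homog_def)
next
  case (Suc k)
  define x where "x = M (j + 2) k $ 1 $ 1"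
  define y where "y = M (j + 2) k $ 2 $ 1"
  define e where "e = riley_sign \<alpha> \<beta> j"
  define e' where "e' = riley_sign \<alpha> \<beta> (Suc j)"
  define y' where "y' = pCons 0 (smult e' x) + y"
  define x' where "x' = x + smult e y'"
  have IH: "degree x \<le> k" "degree y \<le> k" "coeff x 0 = 1" "coeff y 0 = 0"
    "homog (t\<^sup>2 + 1) t k x = (\<Sum>i<Suc (2 * k). t ^ i)"
    "homog (t\<^sup>2 + 1) t k y = t ^ (2 * k) + 1"
    using Suc.IH[of "j + 2"] Suc.prems by (simp_all add: x_def y_def)
  have upt: "[j..<j + 2 * Suc k] = j # Suc j # [j + 2..<j + 2 + 2 * k]"
    by (simp add: upt_conv_Cons)
  have M_Suc: "M j (Suc k) = (vector [vector [1, [:e:]], vector [0, 1]] :: int poly ^ 2 ^ 2) **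
      (vector [vector [1, 0], vector [[:0, e':], 1]] ** M (j + 2) k)"
    using Suc.prems
    by (simp add: M_def upt riley_generator_powi_odd riley_generator_powi_even e_def e'_def
        del: upt_Suc mult_Suc_right)
  have M21: "M j (Suc k) $ 2 $ 1 = y'"
    by (simp add: M_Suc matrix_2x2_mult_nth y'_def x_def y_def)
  have M11: "M j (Suc k) $ 1 $ 1 = x'"
    by (simp add: M_Suc matrix_2x2_mult_nth x'_def y'_def x_def y_def)
  have "degree (smult e' x) \<le> k"
    using IH(1) degree_smult_le order_trans by blast
  then have "degree (pCons 0 (smult e' x)) \<le> Suc k"
    using degree_pCons_le[of 0 "smult e' x"] by linarith
  then have deg_y': "degree y' \<le> Suc k"
    using IH(2) by (simp add: y'_def degree_add_le)
  have "degree (smult e y') \<le> Suc k"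
    using deg_y' degree_smult_le order_trans by blast
  then have deg_x': "degree x' \<le> Suc k"
    using IH(1) by (simp add: x'_def degree_add_le)
  define X where "X = (\<Sum>i<Suc (2 * k). t ^ i)"
  have geom: "(t + 1) * X = t ^ Suc (2 * k) + 1"
    using power_diff_1_eq[of t "Suc (2 * k)"] bit_poly_minus[of 1]
    by (metis X_def diff_conv_add_uminus)
  have sq: "t\<^sup>2 + 1 = (t + 1) * (t + 1)"
    using bit_poly_two_eq_zero by (simp add: power2_eq_square algebra_simps)
  \<comment> \<open>Homogenizing at \<open>Suc k\<close> what has degree at most \<open>k\<close>
    costs one factor \<open>t\<close>.\<close>
  have lift: "homog (t\<^sup>2 + 1) t (Suc k) x = t * X" 
      "homog (t\<^sup>2 + 1) t (Suc k) y = t * (t ^ (2 * k) + 1)"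
    using homog_add_index[OF IH(1), of "t\<^sup>2 + 1" t 1] homog_add_index[OF IH(2), of "t\<^sup>2 + 1" t 1] IH
    by (simp_all add: X_def)
  have "homog (t\<^sup>2 + 1) t (Suc k) y' = (t\<^sup>2 + 1) * X + t * (t ^ (2 * k) + 1)"
    using IH(5) by (simp add: y'_def homog_add homog_pCons homog_smult lift X_def e'_def of_int_riley_sign)
  also have "\<dots> = (t + 1) * (t ^ Suc (2 * k) + 1) + t * (t ^ (2 * k) + 1)"
    using geom by (simp add: sq mult.assoc)
  \<comment> \<open>The terms occurring twice are collected under the factor 2, which
    vanishes.\<close>
  also have "\<dots> = t ^ (2 * Suc k) + 1 + 2 * (t ^ Suc (2 * k) + t)"
    by (simp add: algebra_simps)
  finally have hom_y': "homog (t\<^sup>2 + 1) t (Suc k) y' = t ^ (2 * Suc k) + 1"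
    by (simp add: bit_poly_two_eq_zero)
  have "homog (t\<^sup>2 + 1) t (Suc k) x' = (t * X + 1) + t ^ (2 * Suc k)"
    by (simp add: x'_def homog_add homog_smult lift hom_y' e_def of_int_riley_sign)
  also have "t * X + 1 = (\<Sum>i<Suc (Suc (2 * k)). t ^ i)"
    by (subst sum.lessThan_Suc_shift) (simp add: X_def sum_distrib_left del: sum.lessThan_Suc)
  finally have "homog (t\<^sup>2 + 1) t (Suc k) x' = (\<Sum>i<Suc (2 * Suc k). t ^ i)"
    by simp
  then show ?case
    unfolding M11 M21 using deg_x' deg_y' hom_y' IH(3,4) by (simp add: x'_def y'_def)
qed

lemma irreducible_riley_poly:
  assumes p: "prime p" "odd p" and root: "residue_primroot p 2"
  shows "irreducible (riley_poly p \<beta>)"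
proof -
  define t :: "bit poly" where "t = [:0, 1:]"
  define n where "n = (p - 1) div 2"
  have pn: "p = Suc (2 * n)"
    using p(2) by (simp add: n_def)
  have "CARD(bit) = 2"
    by (simp add: UNIV_bit)
  moreover have "(of_nat p :: bit) \<noteq> 0"
    using p(2) by (simp add: pn)
  ultimately have irr: "irreducible (\<Sum>i<p. t ^ i)"
    unfolding t_def using p(1) root by (intro irreducible_cyclotomic_of_primroot) simp_all
  have deg: "degree (\<Sum>i<p. t ^ i) = 2 * n"
    unfolding pn t_def by (rule degree_sum_powers_X)
  have col: "degree (riley_poly p \<beta>) \<le> n" "coeff (riley_poly p \<beta>) 0 = 1"
    "homog (t\<^sup>2 + 1) t n (riley_poly p \<beta>) = (\<Sum>i<p. t ^ i)"
    \<comment> \<open>The indices from 1 to \<open>p - 1\<close> form \<open>n\<close> pairs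
      starting at the odd index 1.\<close>
    using riley_product_first_column[of 1 p \<beta> n t]
    by (simp_all add: riley_poly_def riley_matrix_def pn del: upt_Suc sum.lessThan_Suc)
  have "degree (t\<^sup>2 + 1) \<le> 2" "degree t \<le> 1"
    by (simp_all add: t_def power2_eq_square one_pCons)
  then show ?thesis
    using irreducible_if_irreducible_homog[of "riley_poly p \<beta>" n "t\<^sup>2 + 1" t] col irr deg by simp
qed

lemma artin_primes_2_subset: "artin_primes_2 \<subseteq> riley_irreducible_primes"
proof
  fix p assume "p \<in> artin_primes_2"
  then have p: "prime p" and root: "residue_primroot p 2"
    by (auto simp: artin_primes_2_def)
  \<comment> \<open>Coprimality of \<open>p\<close> and 2 is part of being a primitive root.\<close>
  then have "odd p"
    by (auto simp: residue_primroot_def coprime_right_2_iff_odd)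
  moreover have "3 \<le> p"
    using prime_ge_2_nat[OF p] \<open>odd p\<close> by (cases "p = 2") auto
  ultimately show "p \<in> riley_irreducible_primes"
    using p root by (simp add: riley_irreducible_primes_def irreducible_riley_poly)
qed

section \<open>Lower prime density\<close>

lemma prime_ratio_mono:
  assumes "A \<subseteq> B"
  shows "prime_ratio A n \<le> prime_ratio B n"
proof -
  have "card {p. prime p \<and> p \<le> n \<and> p \<in> A} \<le> card {p. prime p \<and> p \<le> n \<and> p \<in> B}"
    using assms by (intro card_mono) auto
  then show ?thesis
    by (simp add: prime_ratio_def divide_right_mono)
qed

lemma lower_prime_density_mono:
  assumes "A \<subseteq> B"
  shows "lower_prime_density A \<le> lower_prime_density B"
  unfolding lower_prime_density_def
  by (rule Liminf_mono) (simp add: assms prime_ratio_mono)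

text \<open>This turns the assumed density into a lower density, which can be compared along the
  inclusion of the two sets of primes.\<close>

lemma lower_prime_density_eq:
  assumes "has_prime_density A d"
  shows "lower_prime_density A = ereal d"
  unfolding lower_prime_density_def
  using assms by (intro lim_imp_Liminf) (simp_all add: has_prime_density_def)

theorem corollary6p3:
  assumes "infinite artin_primes_2"
    and "has_prime_density artin_primes_2 artin_constant"
  shows "ereal artin_constant \<le> lower_prime_density riley_irreducible_primes"
  using lower_prime_density_mono[OF artin_primes_2_subset] lower_prime_density_eq[OF assms(2)]
  by simp

end
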